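(* Let $m,n\ge1$ be integers. (1) Any ideal in $\mathcal{P}_0^1(\mathbb{R}^n)$ is both closed and of the form $I^1(E)$ for some semi-algebraic set $E\subset\mathbb{R}^n$ that contains the origin. (2) The only closed ideals in $\mathcal{P}_0^m(\mathbb{R})$ are $\{0\}=I^m(\mathbb{R})$ and $\mathcal{P}_0^m(\mathbb{R})=I^m(\{0\})$.
   Context: Jets. $\mathcal{P}^m(\mathbb{R}^n)$ is the ring of $m$-jets at the origin of $C^m$ real-valued functions on $\mathbb{R}^n$: its elements are identified with real polynomials in $n$ variables of degree at most $m$, and multiplication is polynomial multiplication followed by discarding all monomials of degree $>m$. $\mathcal{P}_0^m(\mathbb{R}^n)\subset\mathcal{P}^m(\mathbb{R}^n)$ is the set of jets vanishing at the origin. For $F\in C^m(\mathbb{R}^n)$, $J^m(F)$ is its $m$-th degree Taylor polynomial at $\vec 0$. An ideal in $\mathcal{P}_0^m(\mathbb{R}^n)$ means an ideal of the ring $\mathcal{P}^m(\mathbb{R}^n)$ contained in $\mathcal{P}_0^m(\mathbb{R}^n)$ (in particular a real linear subspace). For $E\subset\mathbb{R}^n$ with $\vec 0\in E$, $$I^m(E):=\{J^m(F) : F\in C^m(\mathbb{R}^n),\ F=0\text{ on }E\}.$$ Allowed directions. For $\omega\in S^{n-1}$ and $\delta,r>0$ let $\Gamma(\omega,\delta,r)=\{\vec x\in\mathbb{R}^n: 0<|\vec x|<r,\ |\vec x/|\vec x|-\omega|<\delta\}$. A direction $\omega\in S^{n-1}$ is a forbidden direction of an ideal $I\lhd\mathcal{P}_0^m(\mathbb{R}^n)$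 if there exist finitely many $p_1,\dots,p_L\in I$ and $c,\delta,r>0$ such that $|p_1(\vec x)|+\dots+|p_L(\vec x)|>c|\vec x|^m$ for all $\vec x\in\Gamma(\omega,\delta,r)$; otherwise it is an allowed direction. $Allow(I)\subset S^{n-1}$ is the set of allowed directions of $I$. Closed ideals. For $K\ge1$, $\rho>0$ let $\mathrm{Ann}_K(\rho)=\{\vec x\in\mathbb{R}^n:\rho/K<|\vec x|<K\rho\}$. The distance from a point to the empty set is $+\infty$. Let $I\lhd\mathcal{P}_0^m(\mathbb{R}^n)$ be an ideal and $\Omega=Allow(I)$. A jet $p\in\mathcal{P}_0^m(\mathbb{R}^n)$ is implied by $I$ if there exist a constant $A>0$ and $Q_1,\dots,Q_L\in I$ such that: for every $\epsilon>0$ there exist $\delta,r>0$ such that for every $0<\rho\le r$ there exist $F,S_1,\dots,S_L\in C^m(\mathrm{Ann}_4(\rho))$ with (i) $|\partial^\alpha F(\vec x)|\le\epsilon\rho^{m-|\alpha|}$ for all $\vec x\in\mathrm{Ann}_4(\rho)$, $|\alpha|\le m$; (ii) $|\partial^\alpha S_l(\vec x)|\le A\rho^{-|\alpha|}$ for all $\vec x\in\mathrm{Ann}_4(\rho)$, $|\alpha|\le m$, $1\le l\le L$; (iii) $p(\vec x)=F(\vec x)+\sum_{l=1}^L S_l(\vec x)Q_l(\vec x)$ for all $\vec x\in\mathrm{Ann}_2(\rho)$ with $\mathrm{dist}(\vec x/|\vec x|,\Omega)<\delta$. $I$ is closed (implication-closed) if every jet implied by $I$ belongs to $I$. A set is semi-algebraic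 if it can be described by finitely many polynomial equations and inequalities and boolean operations. *)

theory Defs
  imports
    "HOL-Analysis.Analysis"
    "HOL-Library.Poly_Mapping"
    "HOL-Algebra.Ideal"
begin

section \<open>Polynomials and jets\<close>

text \<open>
  The index type \<open>'n\<close> plays the role of \<open>{1..n}\<close>, so \<open>n = CARD('n)\<close> and
  \<open>real ^ 'n\<close> is Euclidean \<open>n\<close>-space. Multi-indices are the monomial exponents of
  \<^theory>\<open>HOL-Library.Poly_Mapping\<close>.
\<close>

type_synonym 'n mindex = "'n \<Rightarrow>\<^sub>0 nat"
type_synonym 'n rpoly = "'n mindex \<Rightarrow>\<^sub>0 real"

definition deg :: "'n::finite mindex \<Rightarrow> nat" where
  "deg \<alpha> = (\<Sum>i\<in>UNIV. poly_mapping.lookup \<alpha> i)"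

definition mfact :: "'n::finite mindex \<Rightarrow> real" where
  "mfact \<alpha> = (\<Prod>i\<in>UNIV. fact (poly_mapping.lookup \<alpha> i))"

definition peval :: "'n::finite rpoly \<Rightarrow> real ^ 'n \<Rightarrow> real" where
  "peval p x =
     (\<Sum>\<alpha>\<in>Poly_Mapping.keys p. poly_mapping.lookup p \<alpha> * (\<Prod>i\<in>UNIV. (x $ i) ^ poly_mapping.lookup \<alpha> i))"

definition jets :: "nat \<Rightarrow> 'n::finite rpoly set" where
  "jets m = {p. \<forall>\<alpha>\<in>Poly_Mapping.keys p. deg \<alpha> \<le> m}"

definition jets0 :: "nat \<Rightarrow> 'n::finite rpoly set" where
  "jets0 m = {p \<in> jets m. peval p 0 = 0}"

definition trunc :: "nat \<Rightarrow> 'n::finite rpoly \<Rightarrow> 'n rpoly" where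
  "trunc m p =
     (\<Sum>\<alpha>\<in>{\<alpha>\<in>Poly_Mapping.keys p. deg \<alpha> \<le> m}. Poly_Mapping.single \<alpha> (poly_mapping.lookup p \<alpha>))"

definition jet_ring :: "nat \<Rightarrow> 'n::finite rpoly ring" where
  "jet_ring m = \<lparr>carrier = jets m, monoid.mult = (\<lambda>p q. trunc m (p * q)), one = 1,
                 zero = 0, add = (+)\<rparr>"

definition jet0_ideal :: "nat \<Rightarrow> 'n::finite rpoly set \<Rightarrow> bool" where
  "jet0_ideal m I \<longleftrightarrow> ideal I (jet_ring m) \<and> I \<subseteq> jets0 m"


section \<open>\<open>C\<^sup>m\<close> functions and their jets at the origin\<close>

definition partial :: "'n::finite \<Rightarrow> (real ^ 'n \<Rightarrow> real) \<Rightarrow> real ^ 'n \<Rightarrow> real" where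
  "partial i f x = frechet_derivative f (at x) (axis i 1)"

text \<open>
  Only used for open \<open>U\<close>; functions on \<open>U\<close> are represented by total functions whose values
  outside \<open>U\<close> are irrelevant.
\<close>

primrec Ck_on :: "nat \<Rightarrow> (real ^ 'n::finite) set \<Rightarrow> (real ^ 'n \<Rightarrow> real) \<Rightarrow> bool" where
  "Ck_on 0 U f \<longleftrightarrow> continuous_on U f"
| "Ck_on (Suc k) U f \<longleftrightarrow>
     (\<forall>x\<in>U. f differentiable (at x)) \<and> (\<forall>i. Ck_on k U (partial i f))"

text \<open>
  The index type carries no order, so the order in which the partial derivatives making up
  \<open>\<partial>\<^sup>\<alpha>\<close> are taken is an arbitrary fixed one. For \<open>C\<^sup>m\<close> functions and \<open>deg \<alpha> \<le> m\<close>, the only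
  case used, it is immaterial by the symmetry of mixed partial derivatives.
\<close>

definition mpartial :: "'n::finite mindex \<Rightarrow> (real ^ 'n \<Rightarrow> real) \<Rightarrow> real ^ 'n \<Rightarrow> real" where
  "mpartial \<alpha> f = foldr partial (SOME js. \<forall>i. count_list js i = poly_mapping.lookup \<alpha> i) f"

definition jet :: "nat \<Rightarrow> (real ^ 'n::finite \<Rightarrow> real) \<Rightarrow> 'n rpoly" where
  "jet m F = (\<Sum>\<alpha>\<in>{\<alpha>. deg \<alpha> \<le> m}. Poly_Mapping.single \<alpha> (mpartial \<alpha> F 0 / mfact \<alpha>))"

definition vanishing_jets :: "nat \<Rightarrow> (real ^ 'n::finite) set \<Rightarrow> 'n rpoly set" where
  "vanishing_jets m E = {jet m F | F. Ck_on m UNIV F \<and> (\<forall>x\<in>E. F x = 0)}"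


section \<open>Allowed directions\<close>

definition cone :: "real ^ 'n::finite \<Rightarrow> real \<Rightarrow> real \<Rightarrow> (real ^ 'n) set" where
  "cone \<omega> \<delta> r = {x. 0 < norm x \<and> norm x < r \<and> norm (x /\<^sub>R norm x - \<omega>) < \<delta>}"

definition forbidden_direction :: "nat \<Rightarrow> 'n::finite rpoly set \<Rightarrow> real ^ 'n \<Rightarrow> bool" where
  "forbidden_direction m I \<omega> \<longleftrightarrow> \<omega> \<in> sphere 0 1 \<and>
     (\<exists>L::nat. \<exists>p. (\<forall>l<L. p l \<in> I) \<and>
       (\<exists>c>0. \<exists>\<delta>>0. \<exists>r>0. \<forall>x\<in>cone \<omega> \<delta> r. (\<Sum>l<L. \<bar>peval (p l) x\<bar>) > c * norm x ^ m))"

definition Allow :: "nat \<Rightarrow> 'n::finite rpoly set \<Rightarrow> (real ^ 'n) set" where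
  "Allow m I = {\<omega> \<in> sphere 0 1. \<not> forbidden_direction m I \<omega>}"


section \<open>Closed ideals\<close>

definition Ann :: "real \<Rightarrow> real \<Rightarrow> (real ^ 'n::finite) set" where
  "Ann K \<rho> = {x. \<rho> / K < norm x \<and> norm x < K * \<rho>}"

text \<open>
  \<^const>\<open>infdist\<close> and \<^const>\<open>setdist\<close> send the empty set to 0; here that distance has to be
  \<open>\<infinity>\<close>, as it is for an infimum in \<^typ>\<open>ereal\<close>.
\<close>

definition edist_set :: "'a::metric_space \<Rightarrow> 'a set \<Rightarrow> ereal" where
  "edist_set x \<Omega> = (INF \<omega>\<in>\<Omega>. ereal (dist x \<omega>))"

definition implied_jet :: "nat \<Rightarrow> 'n::finite rpoly set \<Rightarrow> 'n rpoly \<Rightarrow> bool" where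
  "implied_jet m I p \<longleftrightarrow> p \<in> jets0 m \<and>
    (\<exists>A>0. \<exists>L::nat. \<exists>Q. (\<forall>l<L. Q l \<in> I) \<and>
      (\<forall>\<epsilon>>0. \<exists>\<delta>>0. \<exists>r>0. \<forall>\<rho>. 0 < \<rho> \<and> \<rho> \<le> r \<longrightarrow>
        (\<exists>F S. Ck_on m (Ann 4 \<rho>) F \<and> (\<forall>l<L. Ck_on m (Ann 4 \<rho>) (S l)) \<and>
          (\<forall>x\<in>Ann 4 \<rho>. \<forall>\<alpha>. deg \<alpha> \<le> m \<longrightarrow> \<bar>mpartial \<alpha> F x\<bar> \<le> \<epsilon> * \<rho> ^ (m - deg \<alpha>)) \<and>
          (\<forall>x\<in>Ann 4 \<rho>. \<forall>\<alpha>. deg \<alpha> \<le> m \<longrightarrow>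
             (\<forall>l<L. \<bar>mpartial \<alpha> (S l) x\<bar> \<le> A * \<rho> powi (- int (deg \<alpha>)))) \<and>
          (\<forall>x\<in>Ann 2 \<rho>. edist_set (x /\<^sub>R norm x) (Allow m I) < ereal \<delta> \<longrightarrow>
             peval p x = F x + (\<Sum>l<L. S l x * peval (Q l) x)))))"

definition closed_ideal :: "nat \<Rightarrow> 'n::finite rpoly set \<Rightarrow> bool" where
  "closed_ideal m I \<longleftrightarrow> jet0_ideal m I \<and> (\<forall>p. implied_jet m I p \<longrightarrow> p \<in> I)"


section \<open>Semi-algebraic sets\<close>

inductive semialgebraic :: "(real ^ 'n::finite) set \<Rightarrow> bool" where
  eq: "semialgebraic {x. peval p x = 0}"
| gt: "semialgebraic {x. peval p x > 0}"
| compl: "semialgebraic A \<Longrightarrow> semialgebraic (- A)"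
| un: "semialgebraic A \<Longrightarrow> semialgebraic B \<Longrightarrow> semialgebraic (A \<union> B)"


section \<open>The jets form a commutative ring\<close>

text \<open>
  \<^locale>\<open>ideal\<close> includes the ring axioms for \<^const>\<open>jet_ring\<close>, so without this
  \<^const>\<open>jet0_ideal\<close> might be unsatisfiable.
\<close>

lemma lookup_trunc:
  "poly_mapping.lookup (trunc m p) \<alpha> = (if deg \<alpha> \<le> m then poly_mapping.lookup p \<alpha> else 0)"
proof -
  let ?K = "{\<alpha>\<in>Poly_Mapping.keys p. deg \<alpha> \<le> m}"
  have "poly_mapping.lookup (trunc m p) \<alpha> = (\<Sum>\<beta>\<in>?K. if \<alpha> = \<beta> then poly_mapping.lookup p \<beta> else 0)"
    unfolding trunc_def lookup_sum by (intro sum.cong) (auto simp: lookup_single when_def)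
  also have "\<dots> = (if \<alpha> \<in> ?K then poly_mapping.lookup p \<alpha> else 0)"
    by (subst sum.delta') auto
  finally show ?thesis by (auto simp: in_keys_iff)
qed

lemma trunc_in_jets: "trunc m p \<in> jets m"
  by (auto simp: jets_def in_keys_iff lookup_trunc split: if_splits)

lemma trunc_eq: "p \<in> jets m \<Longrightarrow> trunc m p = p"
  by (intro poly_mapping_eqI) (force simp: lookup_trunc jets_def in_keys_iff)

lemma trunc_add: "trunc m (p + q) = trunc m p + trunc m q"
  by (intro poly_mapping_eqI) (simp add: lookup_trunc lookup_add)

lemma trunc_mult_high:
  assumes "\<And>\<alpha>. \<alpha> \<in> Poly_Mapping.keys p \<Longrightarrow> deg \<alpha> > m"
  shows "trunc m (p * q) = 0"
proof (intro poly_mapping_eqI)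
  fix \<gamma>
  show "poly_mapping.lookup (trunc m (p * q)) \<gamma> = poly_mapping.lookup 0 \<gamma>"
  proof (cases "\<gamma> \<in> Poly_Mapping.keys (p * q)")
    case True
    then obtain \<alpha> \<beta> where "\<gamma> = \<alpha> + \<beta>" "\<alpha> \<in> Poly_Mapping.keys p"
      using keys_mult[of p q] by blast
    then have "deg \<gamma> > m"
      using assms[of \<alpha>] by (simp add: deg_def lookup_add sum.distrib)
    then show ?thesis by (simp add: lookup_trunc)
  qed (simp add: lookup_trunc in_keys_iff)
qed

lemma trunc_mult_left: "trunc m (trunc m p * q) = trunc m (p * q)"
proof -
  have "p * q = trunc m p * q + (p - trunc m p) * q"
    by (simp add: algebra_simps)
  moreover have "trunc m ((p - trunc m p) * q) = 0"
    by (rule trunc_mult_high)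
       (auto simp: in_keys_iff lookup_minus lookup_trunc split: if_splits)
  ultimately have "trunc m (p * q) = trunc m (trunc m p * q) + 0"
    by (simp only: trunc_add)
  then show ?thesis by simp
qed

lemma trunc_mult_right: "trunc m (p * trunc m q) = trunc m (p * q)"
  by (subst (1 2) mult.commute) (rule trunc_mult_left)

lemma jets_add: "p \<in> jets m \<Longrightarrow> q \<in> jets m \<Longrightarrow> p + q \<in> jets m"
  using Poly_Mapping.keys_add[of p q] by (auto simp: jets_def)

lemma jets_const: "0 \<in> jets m" "1 \<in> jets m" "p \<in> jets m \<Longrightarrow> - p \<in> jets m"
  by (auto simp: jets_def deg_def)

lemma cring_jet_ring: "cring (jet_ring m :: 'n::finite rpoly ring)"
proof (rule cringI)
  let ?R = "jet_ring m :: 'n rpoly ring"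
  show "abelian_group ?R"
  proof (rule abelian_groupI)
    fix x assume "x \<in> carrier ?R"
    then show "\<exists>y\<in>carrier ?R. y \<oplus>\<^bsub>?R\<^esub> x = \<zero>\<^bsub>?R\<^esub>"
      by (intro bexI[of _ "- x"]) (simp_all add: jet_ring_def jets_const)
  qed (simp_all add: jet_ring_def jets_add jets_const add.assoc add.commute)
  show "comm_monoid ?R"
  proof (rule comm_monoidI)
    fix x y z :: "'n rpoly"
    have "trunc m (trunc m (x * y) * z) = trunc m (x * trunc m (y * z))"
      by (simp add: trunc_mult_left trunc_mult_right mult.assoc)
    then show "x \<otimes>\<^bsub>?R\<^esub> y \<otimes>\<^bsub>?R\<^esub> z = x \<otimes>\<^bsub>?R\<^esub> (y \<otimes>\<^bsub>?R\<^esub> z)"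
      by (simp add: jet_ring_def)
    show "x \<otimes>\<^bsub>?R\<^esub> y = y \<otimes>\<^bsub>?R\<^esub> x"
      by (simp add: jet_ring_def mult.commute)
  qed (simp_all add: jet_ring_def trunc_in_jets jets_const trunc_eq)
qed (simp add: jet_ring_def distrib_right trunc_add)

end

theory Submission
  imports Defs "HOL-Library.Multiset"
begin

text \<open>
  An ideal of 1-jets vanishing at 0 is a linear space \<open>V\<close> of linear forms; its allowed directions
  are those in \<open>V\<^sup>\<bottom>\<close>, and both closedness and \<open>I = I\<^sup>1(V\<^sup>\<bottom>)\<close> come down to \<open>V\<^sup>\<bottom>\<^sup>\<bottom> = V\<close>.

  In one variable, multiplying a nonzero element of the ideal by a power of \<open>x\<close> and truncating
  leaves a multiple of \<open>x\<^sup>m\<close>. This monomial forbids every direction, so the ideal implies all jets.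
  For the zero ideal both directions are allowed, and an implied jet is \<open>o(\<bar>x\<bar>\<^sup>m)\<close>, hence zero.
\<close>

section \<open>Polynomial functions and their jets\<close>

lemma peval_superset:
  assumes "finite A" "Poly_Mapping.keys p \<subseteq> A"
  shows "peval p x =
    (\<Sum>\<alpha>\<in>A. poly_mapping.lookup p \<alpha> * (\<Prod>i\<in>UNIV. (x $ i) ^ poly_mapping.lookup \<alpha> i))"
  unfolding peval_def using assms by (intro sum.mono_neutral_left) (auto simp: in_keys_iff)

lemma peval_zero [simp]: "peval 0 x = 0"
  by (simp add: peval_def)

lemma peval_single [simp]:
  "peval (Poly_Mapping.single \<alpha> c) x = c * (\<Prod>i\<in>UNIV. (x $ i) ^ poly_mapping.lookup \<alpha> i)"
  by (simp add: peval_def)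

lemma peval_add [simp]: "peval (p + q) x = peval p x + peval q x"
proof -
  let ?A = "Poly_Mapping.keys p \<union> Poly_Mapping.keys q"
  have "Poly_Mapping.keys (p + q) \<subseteq> ?A" by (rule Poly_Mapping.keys_add)
  then show ?thesis
    by (simp add: peval_superset[of ?A] lookup_add distrib_right sum.distrib)
qed

lemma peval_sum: "peval (\<Sum>a\<in>A. f a) x = (\<Sum>a\<in>A. peval (f a) x)"
  by (induction A rule: infinite_finite_induct) auto

lemma peval_at_zero [simp]: "peval p 0 = poly_mapping.lookup p 0"
proof -
  \<comment> \<open>With the convention \<open>0 ^ 0 = 1\<close>, only the monomial of exponent
    \<open>0\<close> survives at the origin.\<close>
  have *: "(\<Prod>i\<in>UNIV. (0 :: real) ^ poly_mapping.lookup \<alpha> i) = (if \<alpha> = 0 then 1 else 0)"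
    for \<alpha> :: "'a mindex"
    by (auto simp: poly_mapping_eq_iff fun_eq_iff)
  show ?thesis
    by (subst peval_superset[of "insert 0 (Poly_Mapping.keys p)"])
       (auto simp: * if_distrib cong: if_cong)
qed

section \<open>Formal partial derivatives of polynomials\<close>

definition pdiff :: "'n::finite \<Rightarrow> 'n rpoly \<Rightarrow> 'n rpoly" where
  "pdiff i p = (\<Sum>\<alpha>\<in>Poly_Mapping.keys p.
     Poly_Mapping.single (\<alpha> - Poly_Mapping.single i 1)
       (poly_mapping.lookup p \<alpha> * real (poly_mapping.lookup \<alpha> i)))"

lemma lookup_pdiff:
  "poly_mapping.lookup (pdiff i p) \<beta> =
     real (Suc (poly_mapping.lookup \<beta> i)) * poly_mapping.lookup p (\<beta> + Poly_Mapping.single i 1)"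
proof -
  let ?e = "Poly_Mapping.single i 1 :: 'a mindex"
  have *: "(poly_mapping.lookup p \<alpha> * real (poly_mapping.lookup \<alpha> i) when \<alpha> - ?e = \<beta>) =
    (if \<alpha> = \<beta> + ?e then real (Suc (poly_mapping.lookup \<beta> i)) * poly_mapping.lookup p \<alpha> else 0)"
    for \<alpha>
  \<comment> \<open>Subtraction of exponents is truncated: if the variable \<open>i\<close> does not
    occur in \<open>\<alpha>\<close>, then \<open>\<alpha> - ?e\<close> is \<open>\<alpha>\<close>
    itself, and it is the zero coefficient that removes the term.\<close>
  proof (cases "poly_mapping.lookup \<alpha> i = 0")
    case True
    then have "\<alpha> \<noteq> \<beta> + ?e" by (auto simp: lookup_add)
    then show ?thesis using True by simp
  next
    case False
    then have "\<alpha> - ?e + ?e = \<alpha>"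
      by (intro poly_mapping_eqI) (auto simp: lookup_add lookup_minus lookup_single when_def)
    then have "\<alpha> - ?e = \<beta> \<longleftrightarrow> \<alpha> = \<beta> + ?e" by auto
    then show ?thesis by (auto simp: when_def lookup_add)
  qed
  show ?thesis
    unfolding pdiff_def lookup_sum lookup_single *
    by (subst sum.delta) (auto simp: in_keys_iff)
qed

text \<open>The derivative is kept in the shape that the product rule produces;
  \<open>partial_peval\<close> evaluates it at \<open>axis i 1\<close>.\<close>

lemma has_derivative_peval:
  "(peval p has_derivative (\<lambda>h. \<Sum>\<alpha>\<in>Poly_Mapping.keys p. poly_mapping.lookup p \<alpha> *
     (\<Sum>i\<in>UNIV. real (poly_mapping.lookup \<alpha> i) * (h $ i * (x $ i) ^ (poly_mapping.lookup \<alpha> i - 1)) *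
       (\<Prod>j\<in>UNIV - {i}. (x $ j) ^ poly_mapping.lookup \<alpha> j)))) (at x)"
proof -
  have nth: "((\<lambda>y. y $ i) has_derivative (\<lambda>h. h $ i)) (at x)" for i :: 'a
    by (rule bounded_linear_imp_has_derivative) (rule bounded_linear_vec_nth)
  have "((\<lambda>y. \<Sum>\<alpha>\<in>Poly_Mapping.keys p. poly_mapping.lookup p \<alpha> *
          (\<Prod>i\<in>UNIV. (y $ i) ^ poly_mapping.lookup \<alpha> i)) has_derivative
        (\<lambda>h. \<Sum>\<alpha>\<in>Poly_Mapping.keys p. poly_mapping.lookup p \<alpha> *
          (\<Sum>i\<in>UNIV. real (poly_mapping.lookup \<alpha> i) * (h $ i * (x $ i) ^ (poly_mapping.lookup \<alpha> i - 1)) *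
            (\<Prod>j\<in>UNIV - {i}. (x $ j) ^ poly_mapping.lookup \<alpha> j)))) (at x)"
    by (intro has_derivative_sum has_derivative_mult_right has_derivative_prod)
       (use has_derivative_power[OF nth] in \<open>simp add: mult.assoc\<close>)
  then show ?thesis by (simp add: peval_def[abs_def])
qed

lemma partial_peval: "partial i (peval p) = peval (pdiff i p)"
proof
  fix x
  \<comment> \<open>In direction \<open>axis i 1\<close> only the summand \<open>k = i\<close> is
    nonzero, and its factors reassemble to the monomial with the exponent of \<open>i\<close>
    lowered by one.\<close>
  have *: "(\<Sum>k\<in>UNIV. real (poly_mapping.lookup \<alpha> k) * (axis i 1 $ k * (x $ k) ^ (poly_mapping.lookup \<alpha> k - 1)) *
            (\<Prod>j\<in>UNIV - {k}. (x $ j) ^ poly_mapping.lookup \<alpha> j)) =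
     real (poly_mapping.lookup \<alpha> i) *
       (\<Prod>j\<in>UNIV. (x $ j) ^ poly_mapping.lookup (\<alpha> - Poly_Mapping.single i 1) j)"
    (is "sum ?f UNIV = ?r") for \<alpha> :: "'a mindex"
  proof -
    have "sum ?f UNIV = ?f i + sum ?f (UNIV - {i})"
      by (rule sum.remove) auto
    also have "sum ?f (UNIV - {i}) = 0"
      by (rule sum.neutral) (auto simp: axis_def)
    also have "?f i + 0 = ?r"
      by (subst (2) prod.remove[of _ i])
         (auto simp: lookup_minus lookup_single when_def axis_def mult.assoc intro!: prod.cong)
    finally show ?thesis .
  qed
  show "partial i (peval p) x = peval (pdiff i p) x"
    unfolding partial_def frechet_derivative_at[OF has_derivative_peval, symmetric] *
    by (simp add: pdiff_def peval_sum mult.assoc)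
qed

lemma peval_differentiable: "peval p differentiable (at x)"
  using has_derivative_peval unfolding differentiable_def by blast

lemma Ck_on_peval: "Ck_on k U (peval p)"
proof (induction k arbitrary: p)
  case 0
  show ?case
    by (auto intro: continuous_at_imp_continuous_on has_derivative_continuous[OF has_derivative_peval])
qed (auto simp: partial_peval peval_differentiable)

section \<open>Iterated partial derivatives and Taylor coefficients\<close>

lemma mpartial_witness:
  "\<exists>js. mpartial \<alpha> = foldr partial js \<and> (\<forall>i. count_list js i = poly_mapping.lookup \<alpha> i)"
proof -
  \<comment> \<open>Over a finite index type every exponent is the count function of a multiset. Any
    listing of it has the required counts, so the choice in \<open>mpartial\<close> yields such a
    list; later arguments rely on the counts alone, whatever the order.\<close>
  obtain js where "mset js = Abs_multiset (poly_mapping.lookup \<alpha>)"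
    using ex_mset by blast
  then have "count (mset js) = poly_mapping.lookup \<alpha>"
    by simp
  then have "\<exists>js. \<forall>i. count_list js i = poly_mapping.lookup \<alpha> i"
    by (auto simp: fun_eq_iff count_mset)
  from someI_ex[OF this] show ?thesis
    by (intro exI[of _ "SOME js. \<forall>i. count_list js i = poly_mapping.lookup \<alpha> i"])
       (auto simp: mpartial_def fun_eq_iff)
qed

lemma mpartial_0 [simp]: "mpartial 0 F = F"
proof -
  obtain js :: "'a list" where js: "mpartial 0 = foldr partial js" "\<forall>i. count_list js i = 0"
    using mpartial_witness[of 0] by auto
  have "js = []" using js(2)[THEN spec, of "hd js"] by (cases js) auto
  with js(1) show ?thesis by simp
qed

lemma mpartial_single [simp]: "mpartial (Poly_Mapping.single i (Suc 0)) F = partial i F"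
proof -
  obtain js where js: "mpartial (Poly_Mapping.single i (Suc 0)) = foldr partial js"
    "\<forall>j. count_list js j = poly_mapping.lookup (Poly_Mapping.single i (Suc 0)) j"
    using mpartial_witness by blast
  from js(2) have "mset js = {#i#}"
    by (intro multiset_eqI) (simp add: count_mset lookup_single when_def)
  with js(1) show ?thesis by simp
qed

lemma mpartial_zero_fun [simp]: "mpartial \<alpha> (\<lambda>x. 0) = (\<lambda>x. 0)"
proof -
  obtain js where js: "mpartial \<alpha> = foldr partial js" using mpartial_witness by blast
  have "partial i (\<lambda>x. 0) = (\<lambda>x. 0)" for i :: 'a
    by (auto simp: partial_def)
  then have "foldr partial js (\<lambda>x. 0) = (\<lambda>x. 0)"
    by (induction js) simp_all
  with js show ?thesis by simp
qed

lemma mfact_add_single: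
  "mfact (\<beta> + Poly_Mapping.single i 1) = real (Suc (poly_mapping.lookup \<beta> i)) * mfact \<beta>"
proof -
  have "mfact \<gamma> = fact (poly_mapping.lookup \<gamma> i) * (\<Prod>j\<in>UNIV - {i}. fact (poly_mapping.lookup \<gamma> j))"
    for \<gamma> :: "'a mindex"
    unfolding mfact_def by (rule prod.remove) auto
  then show ?thesis
    by (simp add: lookup_add lookup_single when_def)
qed

lemma mpartial_peval_0: "mpartial \<alpha> (peval p) 0 = mfact \<alpha> * poly_mapping.lookup p \<alpha>"
proof -
  obtain js where js: "mpartial \<alpha> = foldr partial js"
    "\<forall>i. count_list js i = poly_mapping.lookup \<alpha> i"
    using mpartial_witness by blast
  have ev: "foldr partial is (peval p) = peval (foldr pdiff is p)" for "is"
    by (induction "is") (auto simp: partial_peval)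
  \<comment> \<open>A formal derivative shifts the exponent and multiplies the coefficient by
    exactly the factor by which \<open>mfact\<close> grows. The product of coefficient and
    \<open>mfact\<close> is therefore merely transported, and the induction collects no
    factors.\<close>
  have lk: "poly_mapping.lookup (foldr pdiff is p) \<beta> * mfact \<beta> =
      poly_mapping.lookup p (\<beta> + (\<Sum>i\<leftarrow>is. Poly_Mapping.single i 1)) *
      mfact (\<beta> + (\<Sum>i\<leftarrow>is. Poly_Mapping.single i 1))" for "is" \<beta>
  proof (induction "is" arbitrary: \<beta>)
    case (Cons i "is")
    then show ?case
      using Cons.IH[of "\<beta> + Poly_Mapping.single i 1"]
      by (simp add: lookup_pdiff mfact_add_single add.assoc mult_ac del: of_nat_Suc One_nat_def)
  qed simp
  have "poly_mapping.lookup (\<Sum>i\<leftarrow>is. Poly_Mapping.single i 1) j = count_list is j" for "is" and j :: 'a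
    by (induction "is") (auto simp: lookup_add lookup_single when_def)
  with js(2) have "(\<Sum>i\<leftarrow>js. Poly_Mapping.single i 1) = \<alpha>"
    by (intro poly_mapping_eqI) simp
  with lk[of js 0] show ?thesis
    by (simp add: js(1) ev mfact_def mult.commute)
qed

text \<open>Each component is at most \<open>m\<close>, so the exponents inject into the functions
  from a finite type to \<open>{..m}\<close>. Over an infinite set the sum defining
  \<open>jet\<close> would be 0 by convention.\<close>

lemma finite_deg_le: "finite {\<alpha> :: 'n::finite mindex. deg \<alpha> \<le> m}"
proof (rule finite_imageD)
  have "poly_mapping.lookup \<alpha> i \<le> m" if "deg \<alpha> \<le> m" for \<alpha> :: "'n mindex" and i
    using that member_le_sum[of i UNIV "poly_mapping.lookup \<alpha>"] by (simp add: deg_def)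
  then have "poly_mapping.lookup ` {\<alpha> :: 'n mindex. deg \<alpha> \<le> m} \<subseteq> Pi\<^sub>E UNIV (\<lambda>_. {..m})"
    by auto
  then show "finite (poly_mapping.lookup ` {\<alpha> :: 'n mindex. deg \<alpha> \<le> m})"
    by (rule finite_subset) (auto intro: finite_PiE)
qed (auto intro: inj_onI poly_mapping_eqI)

lemma lookup_jet:
  "poly_mapping.lookup (jet m F) \<alpha> = (if deg \<alpha> \<le> m then mpartial \<alpha> F 0 / mfact \<alpha> else 0)"
  unfolding jet_def lookup_sum lookup_single
  by (simp add: when_def sum.delta finite_deg_le)

lemma jet_in_jets: "jet m F \<in> jets m"
  by (auto simp: jets_def in_keys_iff lookup_jet split: if_splits)

lemma jet_in_jets0: "F 0 = 0 \<Longrightarrow> jet m F \<in> jets0 m"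
  by (simp add: jets0_def jet_in_jets lookup_jet)

lemma jet_zero_fun: "jet m (\<lambda>x. 0) = 0"
  by (intro poly_mapping_eqI) (simp add: lookup_jet)

lemma jet_peval:
  fixes p :: "'n::finite rpoly"
  assumes "p \<in> jets m"
  shows "jet m (peval p) = p"
proof (rule poly_mapping_eqI)
  fix \<alpha> :: "'n mindex"
  have "mfact \<alpha> \<noteq> 0" by (simp add: mfact_def)
  then show "poly_mapping.lookup (jet m (peval p)) \<alpha> = poly_mapping.lookup p \<alpha>"
    using assms by (auto simp: lookup_jet mpartial_peval_0 jets_def in_keys_iff)
qed

section \<open>Ideals of jets\<close>

lemma jet0_idealD:
  assumes "jet0_ideal m I"
  shows jet0_ideal_subset: "I \<subseteq> jets0 m"
    and jet0_ideal_zero: "0 \<in> I"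
    and jet0_ideal_add: "p \<in> I \<Longrightarrow> q \<in> I \<Longrightarrow> p + q \<in> I"
    and jet0_ideal_mult: "p \<in> I \<Longrightarrow> q \<in> jets m \<Longrightarrow> trunc m (q * p) \<in> I"
proof -
  show "I \<subseteq> jets0 m" using assms by (simp add: jet0_ideal_def)
  interpret ideal I "jet_ring m" using assms by (simp add: jet0_ideal_def)
  show "0 \<in> I" using additive_subgroup.zero_closed[OF is_additive_subgroup] by (simp add: jet_ring_def)
  show "p \<in> I \<Longrightarrow> q \<in> I \<Longrightarrow> p + q \<in> I"
    using additive_subgroup.a_closed[OF is_additive_subgroup, of p q] by (simp add: jet_ring_def)
  show "p \<in> I \<Longrightarrow> q \<in> jets m \<Longrightarrow> trunc m (q * p) \<in> I"
    using I_l_closed[of p q] by (simp add: jet_ring_def)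
qed

lemma jet0_idealI:
  fixes I :: "'n::finite rpoly set"
  assumes "I \<subseteq> jets0 m" "0 \<in> I"
    and add: "\<And>p q. p \<in> I \<Longrightarrow> q \<in> I \<Longrightarrow> p + q \<in> I"
    and mult: "\<And>p q. p \<in> I \<Longrightarrow> q \<in> jets m \<Longrightarrow> trunc m (q * p) \<in> I"
  shows "jet0_ideal m I"
proof -
  let ?R = "jet_ring m :: 'n rpoly ring"
  interpret cring ?R by (rule cring_jet_ring)
  have sub: "I \<subseteq> jets m" using assms(1) by (auto simp: jets0_def)
  \<comment> \<open>The negation of the ring is an abstract inverse and has to be identified with
    negation of polynomials.\<close>
  have minus: "\<ominus>\<^bsub>?R\<^esub> p = - p" if "p \<in> I" for p
  proof (rule minus_equality)
    show "- p \<oplus>\<^bsub>?R\<^esub> p = \<zero>\<^bsub>?R\<^esub>" by (simp add: jet_ring_def)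
  qed (use that sub in \<open>auto simp: jet_ring_def jets_const\<close>)
  \<comment> \<open>Negation is multiplication by the constant jet \<open>- 1\<close>; truncation
    does not change the result.\<close>
  have neg: "- p \<in> I" if "p \<in> I" for p
    using mult[OF that, of "- 1"] that sub by (auto simp: jets_const trunc_eq)
  have "ideal I ?R"
  proof (rule idealI)
    show "ring ?R" by (rule ring_axioms)
    show "subgroup I (add_monoid ?R)"
    proof (rule add.subgroupI)
      show "\<ominus>\<^bsub>?R\<^esub> p \<in> I" if "p \<in> I" for p
        using neg[OF that] minus[OF that] by simp
    qed (use sub \<open>0 \<in> I\<close> add in \<open>auto simp: jet_ring_def\<close>)
  qed (use mult in \<open>auto simp: jet_ring_def mult.commute\<close>)
  with assms(1) show ?thesis by (simp add: jet0_ideal_def)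
qed

text \<open>Exponents with sum 0 are both 0, so a constant term of the product must come from
  constant terms of both factors.\<close>

lemma lookup_0_mult_eq_0:
  fixes p q :: "'n::finite rpoly"
  assumes "poly_mapping.lookup p 0 = 0"
  shows "poly_mapping.lookup (q * p) 0 = 0"
proof (rule ccontr)
  assume "poly_mapping.lookup (q * p) 0 \<noteq> 0"
  then have "0 \<in> Poly_Mapping.keys (q * p)" by (simp add: in_keys_iff)
  then obtain \<alpha> \<beta> where \<beta>: "0 = \<alpha> + \<beta>" "\<beta> \<in> Poly_Mapping.keys p"
    using Poly_Mapping.keys_mult[of q p] by blast
  have "poly_mapping.lookup \<beta> i = 0" for i
    using arg_cong[OF \<beta>(1), of "\<lambda>\<gamma>. poly_mapping.lookup \<gamma> i"] by (simp add: lookup_add)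
  then have "\<beta> = 0" by (intro poly_mapping_eqI) simp
  with \<beta>(2) assms show False by (simp add: in_keys_iff)
qed

lemma jet0_ideal_jets0: "jet0_ideal m (jets0 m)"
  by (rule jet0_idealI)
     (auto simp: jets0_def jets_const jets_add lookup_add trunc_in_jets lookup_trunc lookup_0_mult_eq_0)

lemma jet0_ideal_zero_ideal: "jet0_ideal m {0}"
  by (rule jet0_idealI) (auto simp: jets0_def jets_const trunc_eq)

section \<open>Jets of order one\<close>

text \<open>Indexing linear forms by vectors turns spaces of forms into subspaces of
  \<open>real ^ 'n\<close> and evaluation into the inner product, so that orthogonal complements
  express duality.\<close>

definition linform :: "real ^ 'n::finite \<Rightarrow> 'n rpoly" where
  "linform v = (\<Sum>i\<in>UNIV. Poly_Mapping.single (Poly_Mapping.single i 1) (v $ i))"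

lemma peval_linform [simp]: "peval (linform v) x = v \<bullet> x"
proof -
  have "(\<Prod>j\<in>UNIV. (x $ j) ^ poly_mapping.lookup (Poly_Mapping.single i 1) j) = x $ i" for i
    by (subst prod.remove[of _ i]) (auto simp: lookup_single when_def)
  then show ?thesis
    by (simp add: linform_def peval_sum inner_vec_def)
qed

lemma deg_le_1_cases:
  assumes "deg \<alpha> \<le> 1"
  obtains "\<alpha> = 0" | i where "\<alpha> = Poly_Mapping.single i 1"
proof (cases "\<alpha> = 0")
  case False
  then obtain i where i: "poly_mapping.lookup \<alpha> i \<noteq> 0"
    by (auto simp: poly_mapping_eq_iff fun_eq_iff)
  have "deg \<alpha> = poly_mapping.lookup \<alpha> i + (\<Sum>j\<in>UNIV - {i}. poly_mapping.lookup \<alpha> j)"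
    unfolding deg_def by (rule sum.remove) auto
  with assms i have "poly_mapping.lookup \<alpha> i = 1" "(\<Sum>j\<in>UNIV - {i}. poly_mapping.lookup \<alpha> j) = 0"
    by linarith+
  then have "\<alpha> = Poly_Mapping.single i 1"
    by (intro poly_mapping_eqI) (auto simp: lookup_single when_def)
  then show ?thesis using that by blast
qed (use that in blast)

lemma lookup_linform:
  "poly_mapping.lookup (linform v) \<alpha> = (\<Sum>i\<in>UNIV. if Poly_Mapping.single i 1 = \<alpha> then v $ i else 0)"
  by (simp add: linform_def lookup_sum lookup_single when_def)

lemma single_1_eq_iff:
  "Poly_Mapping.single i (1::nat) = Poly_Mapping.single j 1 \<longleftrightarrow> i = j"
  by (metis lookup_single_eq lookup_single_not_eq zero_neq_one)

lemma lookup_linform_single [simp]: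
  "poly_mapping.lookup (linform v) (Poly_Mapping.single j (Suc 0)) = v $ j"
  using single_1_eq_iff[of _ j] by (simp add: lookup_linform)

lemma deg_zero [simp]: "deg 0 = 0"
  by (simp add: deg_def)

lemma deg_single [simp]: "deg (Poly_Mapping.single i k) = k"
  by (simp add: deg_def lookup_single when_def)

text \<open>Among the exponents of degree at most 1, all but \<open>0\<close> are unit vectors, and
  the coefficient of \<open>0\<close> is the value at the origin.\<close>

lemma jets0_1_linform:
  assumes "p \<in> jets0 1"
  shows "p = linform (\<chi> i. poly_mapping.lookup p (Poly_Mapping.single i 1))"
    (is "p = linform ?v")
proof (rule poly_mapping_eqI)
  fix \<alpha>
  have ne: "Poly_Mapping.single i (Suc 0) \<noteq> 0" for i :: 'a
    by (metis lookup_single_eq lookup_zero nat.distinct(1))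
  show "poly_mapping.lookup p \<alpha> = poly_mapping.lookup (linform ?v) \<alpha>"
  proof (cases "deg \<alpha> \<le> 1")
    case True
    then show ?thesis
    proof (cases rule: deg_le_1_cases)
      case 1
      with assms ne show ?thesis by (simp add: jets0_def lookup_linform)
    qed simp
  next
    case False
    then have "poly_mapping.lookup p \<alpha> = 0"
      using assms by (auto simp: jets0_def jets_def in_keys_iff)
    moreover have "Poly_Mapping.single i 1 \<noteq> \<alpha>" for i
      using False by auto
    ultimately show ?thesis by (simp add: lookup_linform)
  qed
qed

lemma linform_add: "linform (v + w) = linform v + linform w"
  by (simp add: linform_def single_add sum.distrib)

lemma linform_in_jets: "linform v \<in> jets 1"
proof -
  have "poly_mapping.lookup (linform v) \<alpha> = 0" if "\<not> deg \<alpha> \<le> 1" for \<alpha>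
    unfolding lookup_linform using that by (intro sum.neutral) auto
  then show ?thesis by (force simp: jets_def in_keys_iff)
qed

lemma jet_ideal_1_subspace:
  assumes "jet0_ideal 1 I"
  shows "subspace {v. linform v \<in> I}"
proof -
  have "linform 0 = (0 :: 'a rpoly)" by (simp add: linform_def)
  moreover have "linform (c *\<^sub>R v) \<in> I" if "linform v \<in> I" for c v
  proof -
    \<comment> \<open>An ideal absorbs scalars because a scalar is a constant jet; the product is
      again a linear form, so truncation preserves it.\<close>
    have "linform (c *\<^sub>R v) = Poly_Mapping.single 0 c * linform v"
      by (simp add: linform_def sum_distrib_left mult_single)
    moreover have "Poly_Mapping.single 0 c \<in> jets 1"
      by (auto simp: jets_def)
    ultimately show ?thesis
      using jet0_ideal_mult[OF assms that, of "Poly_Mapping.single 0 c"]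
        trunc_eq[OF linform_in_jets[of "c *\<^sub>R v"]] by simp
  qed
  ultimately show ?thesis
    using jet0_ideal_zero[OF assms] jet0_ideal_add[OF assms]
    by (auto simp: subspace_def linform_add)
qed

section \<open>Duality between ideals of 1-jets and their zero sets\<close>

definition zero_set :: "'n::finite rpoly set \<Rightarrow> (real ^ 'n) set" where
  "zero_set I = {x. \<forall>p\<in>I. peval p x = 0}"

lemma zero_set_eq_orthogonal_comp:
  assumes "jet0_ideal 1 I"
  shows "zero_set I = {v. linform v \<in> I}\<^sup>\<bottom>"
proof -
  have "\<exists>v. p = linform v" if "p \<in> I" for p
    using jets0_1_linform[of p] jet0_ideal_subset[OF assms] that by blast
  then show ?thesis
    by (fastforce simp: zero_set_def orthogonal_comp_def orthogonal_def)
qed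

text \<open>A form that vanishes on the zero set has its vector in the double orthogonal complement
  of the space of vectors of \<open>I\<close>, which is that space again. Membership in
  \<open>I\<close> thereby reduces to vanishing on a subspace.\<close>

lemma mem_ideal_1_iff:
  assumes "jet0_ideal 1 I"
  shows "p \<in> I \<longleftrightarrow> p \<in> jets0 1 \<and> (\<forall>x\<in>zero_set I. peval p x = 0)"
proof (intro iffI conjI)
  assume *: "p \<in> jets0 1 \<and> (\<forall>x\<in>zero_set I. peval p x = 0)"
  then obtain v where p: "p = linform v" using jets0_1_linform by blast
  with * have "v \<in> (zero_set I)\<^sup>\<bottom>"
    by (auto simp: orthogonal_comp_def orthogonal_def inner_commute)
  then show "p \<in> I"
    using orthogonal_comp_self[OF jet_ideal_1_subspace[OF assms]] p
    by (simp add: zero_set_eq_orthogonal_comp[OF assms])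
qed (use jet0_ideal_subset[OF assms] in \<open>auto simp: zero_set_def\<close>)

section \<open>Semi-algebraicity of the zero set\<close>

lemma semialgebraic_Int:
  assumes "semialgebraic A" "semialgebraic B"
  shows "semialgebraic (A \<inter> B)"
proof -
  have "semialgebraic (- (- A \<union> - B))"
    by (intro semialgebraic.compl semialgebraic.un assms)
  then show ?thesis by simp
qed

lemma semialgebraic_zeros:
  assumes "finite P"
  shows "semialgebraic {x. \<forall>p\<in>P. peval p x = 0}"
  using assms
proof induction
  case empty
  \<comment> \<open>Without equations the set is the whole space, the zero set of the zero
    polynomial.\<close>
  show ?case using semialgebraic.eq[of 0] by simp
next
  case (insert p P)
  then show ?case
    using semialgebraic_Int[OF semialgebraic.eq[of p] insert.IH] by (simp add: Collect_conj_eq)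
qed

text \<open>A basis of the space of forms is finite, and its equations already imply those of the
  whole span.\<close>

lemma semialgebraic_zero_set_1:
  assumes "jet0_ideal 1 I"
  shows "semialgebraic (zero_set I)"
proof -
  let ?V = "{v. linform v \<in> I}"
  obtain B where B: "B \<subseteq> ?V" "independent B" "?V \<subseteq> span B"
    by (rule maximal_independent_subset)
  have "x \<in> ?V\<^sup>\<bottom>" if "\<forall>v\<in>B. v \<bullet> x = 0" for x
    using that B(3) orthogonal_to_span[of _ B x]
    by (fastforce simp: orthogonal_comp_def orthogonal_def inner_commute)
  then have "?V\<^sup>\<bottom> = {x. \<forall>p\<in>linform ` B. peval p x = 0}"
    using B(1) by (auto simp: orthogonal_comp_def orthogonal_def)
  then show ?thesis
    using semialgebraic_zeros[of "linform ` B"] independent_imp_finite[OF B(2)]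
    by (simp add: zero_set_eq_orthogonal_comp[OF assms])
qed

section \<open>The 1-jets of functions vanishing on the zero set\<close>

lemma peval_jet_1:
  assumes "F differentiable (at 0)" "F 0 = 0"
  shows "peval (jet 1 F) x = frechet_derivative F (at 0) x"
proof -
  \<comment> \<open>Since \<open>F 0 = 0\<close>, the jet is the gradient as a linear form. By
    linearity this is the full differential, so the jet also gives derivatives along arbitrary
    vectors.\<close>
  have "jet 1 F = linform (\<chi> i. partial i F 0)"
    by (subst jets0_1_linform[OF jet_in_jets0[of F, OF assms(2)]])
       (simp add: lookup_jet mfact_def lookup_single when_def if_distrib cong: if_cong)
  moreover have "linear (frechet_derivative F (at 0))"
    using assms(1) by (rule linear_frechet_derivative)
  then have "frechet_derivative F (at 0) (\<Sum>i\<in>UNIV. x $ i *\<^sub>R axis i 1) = (\<Sum>i\<in>UNIV. x $ i * partial i F 0)"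
    by (simp add: linear_sum linear_scale partial_def)
  moreover have "(\<Sum>i\<in>UNIV. x $ i *\<^sub>R axis i 1) = x"
    using basis_expansion[of x] by (simp add: scalar_mult_eq_scaleR)
  ultimately show ?thesis by (simp add: inner_vec_def mult.commute)
qed

text \<open>An element of \<open>I\<close> is the jet of its own polynomial function, which vanishes
  on the zero set. Conversely, a function vanishing on a subspace has zero derivative along each
  vector of it; its jet then vanishes there, and duality puts it into \<open>I\<close>.\<close>

lemma vanishing_jets_1_zero_set:
  assumes "jet0_ideal 1 I"
  shows "vanishing_jets 1 (zero_set I) = I"
proof (intro equalityI subsetI)
  fix p assume "p \<in> I"
  moreover have "p \<in> jets 1"
    using jet0_ideal_subset[OF assms] \<open>p \<in> I\<close> by (auto simp: jets0_def)
  ultimately show "p \<in> vanishing_jets 1 (zero_set I)"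
    unfolding vanishing_jets_def
    by (auto simp: zero_set_def jet_peval Ck_on_peval intro!: exI[of _ "peval p"] simp del: Ck_on.simps)
next
  fix p assume "p \<in> vanishing_jets 1 (zero_set I)"
  then obtain F where p: "p = jet 1 F" and F: "Ck_on 1 UNIV F" "\<And>x. x \<in> zero_set I \<Longrightarrow> F x = 0"
    by (auto simp: vanishing_jets_def)
  have sub: "subspace (zero_set I)"
    by (simp add: zero_set_eq_orthogonal_comp[OF assms] subspace_orthogonal_comp)
  then have F0: "F 0 = 0" by (simp add: F(2) subspace_0)
  have dF: "F differentiable (at 0)" using F(1) by simp
  have "peval p x = 0" if x: "x \<in> zero_set I" for x
  proof -
    \<comment> \<open>Writing the origin as \<open>0 *\<^sub>R x\<close> prepares the chain rule
      along the line through \<open>x\<close>.\<close>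
    have "(F has_derivative frechet_derivative F (at 0)) (at (0 *\<^sub>R x))"
      using dF by (simp add: frechet_derivative_works)
    moreover have "((\<lambda>t. t *\<^sub>R x) has_derivative (\<lambda>t. t *\<^sub>R x)) (at 0)"
      by (rule bounded_linear_imp_has_derivative) (rule bounded_linear_scaleR_left)
    ultimately have "((\<lambda>t. F (t *\<^sub>R x)) has_derivative (\<lambda>t. frechet_derivative F (at 0) (t *\<^sub>R x))) (at 0)"
      by (rule has_derivative_compose[rotated])
    moreover have "(\<lambda>t. F (t *\<^sub>R x)) = (\<lambda>t. 0)"
      using F(2) sub x by (auto simp: subspace_scale)
    ultimately have "(\<lambda>t. frechet_derivative F (at 0) (t *\<^sub>R x)) = (\<lambda>t. 0)"
      by (auto intro: has_derivative_unique)
    from fun_cong[OF this, of 1] show ?thesis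
      using peval_jet_1[OF dF F0, of x] by (simp add: p)
  qed
  then show "p \<in> I"
    using mem_ideal_1_iff[OF assms] jet_in_jets0[of F, OF F0] p by blast
qed

section \<open>Allowed directions and implied jets along a ray\<close>

lemma Allow_if_zero:
  assumes "\<omega> \<in> sphere 0 1" "\<And>p t. p \<in> I \<Longrightarrow> t > 0 \<Longrightarrow> peval p (t *\<^sub>R \<omega>) = 0"
  shows "\<omega> \<in> Allow m I"
proof -
  have False if "forbidden_direction m I \<omega>"
  proof -
    from that obtain L :: nat and p c \<delta> r where p: "\<And>l. l < L \<Longrightarrow> p l \<in> I" and "c > 0" "\<delta> > 0" "r > 0"
      and *: "\<And>x. x \<in> cone \<omega> \<delta> r \<Longrightarrow> (\<Sum>l<L. \<bar>peval (p l) x\<bar>) > c * norm x ^ m"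
      unfolding forbidden_direction_def by blast
    \<comment> \<open>The ray through \<open>\<omega>\<close> meets every cone around
      \<open>\<omega>\<close>. At such a point the sum of absolute values is 0, yet it would have to
      exceed a nonnegative number.\<close>
    have "(r/2) *\<^sub>R \<omega> \<in> cone \<omega> \<delta> r"
      using assms(1) \<open>r > 0\<close> \<open>\<delta> > 0\<close> by (auto simp: cone_def)
    from *[OF this] have "c * norm ((r/2) *\<^sub>R \<omega>) ^ m < 0"
      using assms(2) p \<open>r > 0\<close> by simp
    moreover have "c * norm ((r/2) *\<^sub>R \<omega>) ^ m \<ge> 0" using \<open>c > 0\<close> by simp
    ultimately show False by linarith
  qed
  with assms(1) show ?thesis by (auto simp: Allow_def)
qed

lemma edist_set_le: "\<omega> \<in> \<Omega> \<Longrightarrow> edist_set x \<Omega> \<le> ereal (dist x \<omega>)"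
  unfolding edist_set_def by (rule INF_lower)

text \<open>
  Along a ray on which \<open>I\<close> vanishes, the remainder \<open>F\<close> in the definition of implication is all
  of the jet.
\<close>

lemma implied_jet_bound:
  assumes "implied_jet m I p" "\<omega> \<in> sphere 0 1"
    and "\<And>q t. q \<in> I \<Longrightarrow> t > 0 \<Longrightarrow> peval q (t *\<^sub>R \<omega>) = 0" and "\<epsilon> > 0"
  obtains r where "r > 0" "\<And>\<rho>. 0 < \<rho> \<Longrightarrow> \<rho> \<le> r \<Longrightarrow> \<bar>peval p (\<rho> *\<^sub>R \<omega>)\<bar> \<le> \<epsilon> * \<rho> ^ m"
proof -
  have \<omega>: "\<omega> \<in> Allow m I" using assms(2,3) by (rule Allow_if_zero)
  from assms(1) obtain A and L :: nat and Q where "\<forall>l<L. Q l \<in> I" and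
    *: "\<forall>\<epsilon>>0. \<exists>\<delta>>0. \<exists>r>0. \<forall>\<rho>. 0 < \<rho> \<and> \<rho> \<le> r \<longrightarrow>
        (\<exists>F S. Ck_on m (Ann 4 \<rho>) F \<and> (\<forall>l<L. Ck_on m (Ann 4 \<rho>) (S l)) \<and>
          (\<forall>x\<in>Ann 4 \<rho>. \<forall>\<alpha>. deg \<alpha> \<le> m \<longrightarrow> \<bar>mpartial \<alpha> F x\<bar> \<le> \<epsilon> * \<rho> ^ (m - deg \<alpha>)) \<and>
          (\<forall>x\<in>Ann 4 \<rho>. \<forall>\<alpha>. deg \<alpha> \<le> m \<longrightarrow>
             (\<forall>l<L. \<bar>mpartial \<alpha> (S l) x\<bar> \<le> A * \<rho> powi (- int (deg \<alpha>)))) \<and>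
          (\<forall>x\<in>Ann 2 \<rho>. edist_set (x /\<^sub>R norm x) (Allow m I) < ereal \<delta> \<longrightarrow>
             peval p x = F x + (\<Sum>l<L. S l x * peval (Q l) x)))"
      (is "\<forall>\<epsilon>>0. \<exists>\<delta>>0. \<exists>r>0. \<forall>\<rho>. 0 < \<rho> \<and> \<rho> \<le> r \<longrightarrow> (\<exists>F S. ?P \<epsilon> \<delta> \<rho> F S)")
    unfolding implied_jet_def by blast
  from *[THEN spec, THEN mp, OF \<open>\<epsilon> > 0\<close>] obtain \<delta> r where "\<delta> > 0" "r > 0" and
    **: "\<forall>\<rho>. 0 < \<rho> \<and> \<rho> \<le> r \<longrightarrow> (\<exists>F S. ?P \<epsilon> \<delta> \<rho> F S)"
    by blast
  show ?thesis
  proof (rule that[OF \<open>r > 0\<close>])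
    fix \<rho> :: real assume \<rho>: "0 < \<rho>" "\<rho> \<le> r"
    let ?x = "\<rho> *\<^sub>R \<omega>"
    obtain F S where "?P \<epsilon> \<delta> \<rho> F S"
      using **[THEN spec, THEN mp, of \<rho>] \<rho> by blast
    then have F: "\<forall>x\<in>Ann 4 \<rho>. \<forall>\<alpha>. deg \<alpha> \<le> m \<longrightarrow> \<bar>mpartial \<alpha> F x\<bar> \<le> \<epsilon> * \<rho> ^ (m - deg \<alpha>)"
      and pF: "\<forall>x\<in>Ann 2 \<rho>. edist_set (x /\<^sub>R norm x) (Allow m I) < ereal \<delta> \<longrightarrow>
             peval p x = F x + (\<Sum>l<L. S l x * peval (Q l) x)"
      by simp_all
    have x: "?x \<in> Ann 2 \<rho>" "?x \<in> Ann 4 \<rho>" "?x /\<^sub>R norm ?x = \<omega>"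
      using assms(2) \<rho> by (auto simp: Ann_def)
    \<comment> \<open>An allowed direction has distance at most 0 from the set of allowed
      directions, so the decomposition holds at this point for every
      \<open>\<delta>\<close>.\<close>
    have "edist_set \<omega> (Allow m I) < ereal \<delta>"
      using edist_set_le[OF \<omega>, of \<omega>] \<open>\<delta> > 0\<close>
      by (simp add: le_less_trans zero_ereal_def)
    with pF x have "peval p ?x = F ?x + (\<Sum>l<L. S l ?x * peval (Q l) ?x)" by metis
    also have "\<dots> = F ?x"
      using assms(3) \<rho> \<open>\<forall>l<L. Q l \<in> I\<close> by simp
    \<comment> \<open>This is the derivative bound for the exponent \<open>0\<close>.\<close>
    also have "\<bar>F ?x\<bar> \<le> \<epsilon> * \<rho> ^ m"
      using F[rule_format, OF x(2), of 0] by (simp add: deg_def)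
    finally show "\<bar>peval p ?x\<bar> \<le> \<epsilon> * \<rho> ^ m" .
  qed
qed

text \<open>Along a ray in the zero set an implied jet is homogeneous of degree 1 and also bounded
  by \<open>\<epsilon> * \<rho>\<close> for each \<epsilon>, so it vanishes there; duality puts it
  into \<open>I\<close>.\<close>

lemma closed_ideal_1:
  assumes I: "jet0_ideal 1 I"
  shows "closed_ideal 1 I"
  unfolding closed_ideal_def
proof (intro conjI allI impI)
  fix p assume p: "implied_jet 1 I p"
  then have "p \<in> jets0 1" by (simp add: implied_jet_def)
  then obtain v where v: "p = linform v" using jets0_1_linform by blast
  have sub: "subspace (zero_set I)"
    by (simp add: zero_set_eq_orthogonal_comp[OF I] subspace_orthogonal_comp)
  have "peval p x = 0" if "x \<in> zero_set I" for x
  proof (cases "x = 0")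
    case False
    define \<omega> where "\<omega> = x /\<^sub>R norm x"
    have \<omega>: "\<omega> \<in> sphere 0 1" using False by (simp add: \<omega>_def)
    have "t *\<^sub>R \<omega> \<in> zero_set I" for t
      using sub that by (simp add: \<omega>_def subspace_scale)
    then have zero: "peval q (t *\<^sub>R \<omega>) = 0" if "q \<in> I" for q t
      using that by (auto simp: zero_set_def)
    have "\<bar>v \<bullet> \<omega>\<bar> \<le> \<epsilon>" if "\<epsilon> > 0" for \<epsilon>
    proof -
      obtain r where r: "r > 0" "\<And>\<rho>. 0 < \<rho> \<Longrightarrow> \<rho> \<le> r \<Longrightarrow> \<bar>peval p (\<rho> *\<^sub>R \<omega>)\<bar> \<le> \<epsilon> * \<rho> ^ 1"
        using implied_jet_bound[OF p \<omega> zero \<open>\<epsilon> > 0\<close>] by blast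
      \<comment> \<open>By homogeneity a single radius is enough: both sides scale with
        \<open>r\<close>, which cancels.\<close>
      from r(2)[of r] \<open>r > 0\<close> have "r * \<bar>v \<bullet> \<omega>\<bar> \<le> r * \<epsilon>"
        by (simp add: v abs_mult mult.commute)
      with \<open>r > 0\<close> show ?thesis by simp
    qed
    then have "v \<bullet> \<omega> = 0" by (metis abs_le_zero_iff field_le_epsilon add_0)
    then show ?thesis using False by (simp add: v \<omega>_def)
  qed (simp add: v del: peval_at_zero)
  with \<open>p \<in> jets0 1\<close> show "p \<in> I" using mem_ideal_1_iff[OF I] by blast
qed (fact I)

section \<open>Jets in one variable\<close>

lemma mindex_1_eq: "\<alpha> = Poly_Mapping.single (1::1) (deg \<alpha>)"
proof (rule poly_mapping_eqI)
  fix k :: 1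
  have "k = 1" by (rule num1_eq1)
  show "poly_mapping.lookup \<alpha> k = poly_mapping.lookup (Poly_Mapping.single 1 (deg \<alpha>)) k"
    unfolding \<open>k = 1\<close> by (simp add: deg_def)
qed

lemma deg_inj_1: "deg \<alpha> = deg \<beta> \<Longrightarrow> \<alpha> = (\<beta> :: 1 mindex)"
  using mindex_1_eq[of \<alpha>] mindex_1_eq[of \<beta>] by simp

lemma peval_1:
  "peval p (x :: real ^ 1) = (\<Sum>\<alpha>\<in>Poly_Mapping.keys p. poly_mapping.lookup p \<alpha> * (x $ 1) ^ deg \<alpha>)"
  by (simp add: peval_def deg_def)

text \<open>In one variable distinct exponents have distinct degrees, so the lowest term is strictly
  below all others.\<close>

lemma obtain_lowest_term:
  fixes p :: "1 rpoly"
  assumes "p \<noteq> 0"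
  obtains \<beta> where "\<beta> \<in> Poly_Mapping.keys p"
    "\<And>\<alpha>. \<alpha> \<in> Poly_Mapping.keys p \<Longrightarrow> \<alpha> \<noteq> \<beta> \<Longrightarrow> deg \<beta> < deg \<alpha>"
proof -
  obtain \<beta> where "\<beta> \<in> Poly_Mapping.keys p" "\<And>\<alpha>. \<alpha> \<in> Poly_Mapping.keys p \<Longrightarrow> deg \<beta> \<le> deg \<alpha>"
    using assms ex_has_least_nat[of "\<lambda>\<alpha>. \<alpha> \<in> Poly_Mapping.keys p" _ deg] by fastforce
  with deg_inj_1 show ?thesis by (intro that) (auto simp: order_less_le)
qed

text \<open>Dividing by the lowest power \<rho>^(deg \<beta>) leaves a polynomial \<open>q\<close>
  whose value at 0 is the lowest coefficient. As \<open>deg \<beta> \<le> m\<close>, smallness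
  relative to \<rho>^m forces \<open>q\<close> to tend to 0, a contradiction.\<close>

lemma small_poly_eq_zero:
  fixes p :: "1 rpoly"
  assumes "p \<in> jets m"
    and small: "\<And>\<epsilon>. \<epsilon> > 0 \<Longrightarrow> \<exists>r>0. \<forall>\<rho>. 0 < \<rho> \<and> \<rho> \<le> r \<longrightarrow> \<bar>peval p (\<rho> *\<^sub>R 1)\<bar> \<le> \<epsilon> * \<rho> ^ m"
  shows "p = 0"
proof (rule ccontr)
  assume "p \<noteq> 0"
  then obtain \<beta> where \<beta>: "\<beta> \<in> Poly_Mapping.keys p"
    "\<And>\<alpha>. \<alpha> \<in> Poly_Mapping.keys p \<Longrightarrow> \<alpha> \<noteq> \<beta> \<Longrightarrow> deg \<beta> < deg \<alpha>"
    using obtain_lowest_term by blast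
  define q :: "real \<Rightarrow> real" where
    "q \<rho> = (\<Sum>\<alpha>\<in>Poly_Mapping.keys p. poly_mapping.lookup p \<alpha> * \<rho> ^ (deg \<alpha> - deg \<beta>))" for \<rho>
  have le: "deg \<beta> \<le> deg \<alpha>" if "\<alpha> \<in> Poly_Mapping.keys p" for \<alpha>
    using \<beta>(2)[OF that] by (cases "\<alpha> = \<beta>") auto
  have q: "peval p (\<rho> *\<^sub>R 1) = \<rho> ^ deg \<beta> * q \<rho>" for \<rho>
    unfolding peval_1 q_def sum_distrib_left
    using le by (intro sum.cong) (auto simp: mult_ac simp flip: power_add)
  have "(q \<longlongrightarrow> q 0) (at_right 0)"
    unfolding q_def[abs_def] by (intro tendsto_intros)
  moreover have "(q \<longlongrightarrow> 0) (at_right 0)"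
  proof (rule tendstoI)
    fix e :: real assume "e > 0"
    then obtain r where r: "r > 0" "\<And>\<rho>. 0 < \<rho> \<Longrightarrow> \<rho> \<le> r \<Longrightarrow> \<bar>peval p (\<rho> *\<^sub>R 1)\<bar> \<le> e/2 * \<rho> ^ m"
      using small[of "e/2"] by auto
    \<comment> \<open>The bound \<open>\<rho> < 1\<close> makes the higher power \<rho>^m the
      smaller one; \<open>e/2\<close> leaves room for strictness.\<close>
    have "\<bar>q \<rho>\<bar> < e" if "0 < \<rho>" "\<rho> < min r 1" for \<rho>
    proof -
      have "\<rho> ^ m \<le> \<rho> ^ deg \<beta>"
        using that \<beta>(1) assms(1) by (intro power_decreasing) (auto simp: jets_def)
      then have "e/2 * \<rho> ^ m \<le> e/2 * \<rho> ^ deg \<beta>"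
        using \<open>e > 0\<close> by (intro mult_left_mono) auto
      moreover have "\<rho> ^ deg \<beta> * \<bar>q \<rho>\<bar> \<le> e/2 * \<rho> ^ m"
        using r(2)[of \<rho>] that by (simp add: q abs_mult)
      ultimately have "\<rho> ^ deg \<beta> * \<bar>q \<rho>\<bar> \<le> \<rho> ^ deg \<beta> * (e/2)"
        by (simp only: mult.commute[of "e/2"])
      then have "\<bar>q \<rho>\<bar> \<le> e/2" using that by simp
      with \<open>e > 0\<close> show ?thesis by simp
    qed
    then show "\<forall>\<^sub>F \<rho> in at_right 0. dist (q \<rho>) 0 < e"
      using \<open>r > 0\<close> by (auto simp: eventually_at_right_field intro!: exI[of _ "min r 1"])
  qed
  ultimately have "q 0 = 0" by (rule tendsto_unique[OF trivial_limit_at_right_real])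
  moreover have "q 0 = poly_mapping.lookup p \<beta>"
  proof -
    \<comment> \<open>At 0 the term of \<beta> has the factor \<open>0 ^ 0 = 1\<close>, while all
      others carry a positive power of 0.\<close>
    have "q 0 = (\<Sum>\<alpha>\<in>Poly_Mapping.keys p. if \<alpha> = \<beta> then poly_mapping.lookup p \<alpha> else 0)"
      unfolding q_def using \<beta>(2) by (intro sum.cong) auto
    then show ?thesis using \<beta>(1) by simp
  qed
  ultimately show False using \<beta>(1) by (simp add: in_keys_iff)
qed

text \<open>The zero ideal vanishes along every ray. The bound along the positive half-line alone
  already forces an implied jet to be zero.\<close>

lemma closed_ideal_zero: "closed_ideal m ({0} :: 1 rpoly set)"
  unfolding closed_ideal_def
proof (intro conjI allI impI)
  fix p :: "1 rpoly" assume p: "implied_jet m {0} p"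
  have "(1 :: real ^ 1) \<in> sphere 0 1" by (simp add: norm_real)
  have "p = 0"
  proof (rule small_poly_eq_zero)
    show "p \<in> jets m" using p by (simp add: implied_jet_def jets0_def)
    fix \<epsilon> :: real assume "\<epsilon> > 0"
    with implied_jet_bound[OF p \<open>(1 :: real ^ 1) \<in> sphere 0 1\<close>, of \<epsilon>]
    show "\<exists>r>0. \<forall>\<rho>. 0 < \<rho> \<and> \<rho> \<le> r \<longrightarrow> \<bar>peval p (\<rho> *\<^sub>R 1)\<bar> \<le> \<epsilon> * \<rho> ^ m"
      by (metis peval_zero singletonD)
  qed
  then show "p \<in> {0}" by simp
qed (rule jet0_ideal_zero_ideal)

section \<open>Nonzero ideals in one variable\<close>

lemma trunc_sum: "trunc m (\<Sum>a\<in>A. f a) = (\<Sum>a\<in>A. trunc m (f a))"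
  by (induction A rule: infinite_finite_induct) (auto simp: trunc_add trunc_eq jets_const)

lemma trunc_single:
  "trunc m (Poly_Mapping.single \<alpha> c) = (if deg \<alpha> \<le> m then Poly_Mapping.single \<alpha> c else 0)"
  by (intro poly_mapping_eqI) (auto simp: lookup_trunc lookup_single when_def)

lemma deg_add: "deg (\<alpha> + \<beta>) = deg \<alpha> + deg \<beta>"
  by (simp add: deg_def lookup_add sum.distrib)

lemma top_monomial_in_ideal:
  fixes I :: "1 rpoly set"
  assumes "jet0_ideal m I" "I \<noteq> {0}"
  obtains \<mu> c where "deg \<mu> = m" "c \<noteq> 0" "Poly_Mapping.single \<mu> c \<in> I"
proof -
  obtain p where p: "p \<in> I" "p \<noteq> 0" using assms jet0_ideal_zero by blast
  then obtain \<beta> where \<beta>: "\<beta> \<in> Poly_Mapping.keys p"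
    "\<And>\<alpha>. \<alpha> \<in> Poly_Mapping.keys p \<Longrightarrow> \<alpha> \<noteq> \<beta> \<Longrightarrow> deg \<beta> < deg \<alpha>"
    using obtain_lowest_term by blast
  have le: "deg \<beta> \<le> m"
    using p(1) \<beta>(1) jet0_ideal_subset[OF assms(1)] by (auto simp: jets0_def jets_def)
  \<comment> \<open>This power lifts the lowest term to degree exactly \<open>m\<close> and every
    other term beyond \<open>m\<close>, where truncation removes it.\<close>
  define \<gamma> :: "1 mindex" where "\<gamma> = Poly_Mapping.single 1 (m - deg \<beta>)"
  have deg\<gamma>: "deg \<gamma> = m - deg \<beta>" by (simp add: \<gamma>_def)
  have expand: "p = (\<Sum>\<alpha>\<in>Poly_Mapping.keys p. Poly_Mapping.single \<alpha> (poly_mapping.lookup p \<alpha>))"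
    by (intro poly_mapping_eqI)
       (simp add: lookup_sum lookup_single when_def sum.delta in_keys_iff)
  have "trunc m (Poly_Mapping.single \<gamma> 1 * p) =
    (\<Sum>\<alpha>\<in>Poly_Mapping.keys p. trunc m (Poly_Mapping.single (\<gamma> + \<alpha>) (poly_mapping.lookup p \<alpha>)))"
    by (subst expand) (simp add: sum_distrib_left mult_single trunc_sum)
  also have "\<dots> = (\<Sum>\<alpha>\<in>Poly_Mapping.keys p.
      if \<alpha> = \<beta> then Poly_Mapping.single (\<gamma> + \<alpha>) (poly_mapping.lookup p \<alpha>) else 0)"
    using le \<beta>(2) by (intro sum.cong) (force simp: trunc_single deg_add deg\<gamma>)+
  also have "\<dots> = Poly_Mapping.single (\<gamma> + \<beta>) (poly_mapping.lookup p \<beta>)"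
    using \<beta>(1) by simp
  finally have "Poly_Mapping.single (\<gamma> + \<beta>) (poly_mapping.lookup p \<beta>) \<in> I"
    using jet0_ideal_mult[OF assms(1) p(1), of "Poly_Mapping.single \<gamma> 1"]
    by (simp add: jets_def deg\<gamma>)
  moreover have "deg (\<gamma> + \<beta>) = m" using le by (simp add: deg_add deg\<gamma>)
  ultimately show ?thesis using that \<beta>(1) by (auto simp: in_keys_iff)
qed

lemma Allow_empty_1:
  fixes I :: "1 rpoly set"
  assumes "jet0_ideal m I" "I \<noteq> {0}"
  shows "Allow m I = {}"
proof -
  obtain \<mu> c where \<mu>: "deg \<mu> = m" "c \<noteq> 0" "Poly_Mapping.single \<mu> c \<in> I"
    using top_monomial_in_ideal[OF assms] .
  have "forbidden_direction m I \<omega>" if "\<omega> \<in> sphere 0 1" for \<omega>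
  proof -
    \<comment> \<open>On the line the absolute value of the monomial equals
      \<open>\<bar>c\<bar> * norm x ^ m\<close> at every point, so any cone serves; halving the
      constant gives the strict inequality.\<close>
    have "(\<Sum>l<1::nat. \<bar>peval (Poly_Mapping.single \<mu> c) x\<bar>) > \<bar>c\<bar>/2 * norm x ^ m"
      if "x \<in> cone \<omega> 1 1" for x
    proof -
      have "norm x ^ m > 0" using that by (simp add: cone_def)
      then have "\<bar>c\<bar>/2 * norm x ^ m < \<bar>c\<bar> * norm x ^ m"
        using \<mu>(2) by (intro mult_strict_right_mono) auto
      also have "\<dots> = \<bar>peval (Poly_Mapping.single \<mu> c) x\<bar>"
        using \<mu>(1,2) by (simp add: peval_1 norm_real abs_mult power_abs del: peval_single)
      finally show ?thesis by simp
    qed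
    with that \<mu> show ?thesis
      unfolding forbidden_direction_def
      by (intro conjI exI[of _ "1::nat"] exI[of _ "\<lambda>_. Poly_Mapping.single \<mu> c"] exI[of _ "\<bar>c\<bar>/2"]
          exI[of _ "1::real"]) auto
  qed
  then show ?thesis by (auto simp: Allow_def)
qed

lemma Ck_on_zero_fun: "Ck_on k U (\<lambda>x. 0)"
  using Ck_on_peval[of k U 0] by (simp add: peval_zero[abs_def])

text \<open>
  Without allowed directions the decomposition is required nowhere, so \<open>F = 0\<close> and \<open>L = 0\<close>
  witness that every jet is implied.
\<close>

lemma implied_jet_if_Allow_empty:
  assumes "Allow m I = {}" "p \<in> jets0 m"
  shows "implied_jet m I p"
  unfolding implied_jet_def
  by (intro conjI allI impI exI[of _ "1::real"] exI[of _ "0::nat"] exI[of _ "\<lambda>_. 0"] exI[of _ "\<lambda>_ _. 0"])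
     (use assms in \<open>auto simp: edist_set_def Ck_on_zero_fun top_ereal_def\<close>)

text \<open>A nonzero ideal has no allowed directions and hence implies every jet in
  \<open>jets0 m\<close>; if closed, it contains them all. In the other direction,
  \<open>jets0 m\<close> is closed since implied jets lie in it by definition.\<close>

lemma closed_ideals_1: "{I :: 1 rpoly set. closed_ideal m I} = {{0}, jets0 m}"
proof (intro equalityI subsetI)
  fix I :: "1 rpoly set" assume "I \<in> {I. closed_ideal m I}"
  then have I: "jet0_ideal m I" "\<And>p. implied_jet m I p \<Longrightarrow> p \<in> I"
    by (auto simp: closed_ideal_def)
  show "I \<in> {{0}, jets0 m}"
  proof (cases "I = {0}")
    case False
    then have "jets0 m \<subseteq> I"
      using I implied_jet_if_Allow_empty[OF Allow_empty_1[OF I(1)]] by blast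
    with jet0_ideal_subset[OF I(1)] show ?thesis by auto
  qed simp
next
  have "closed_ideal m (jets0 m :: 1 rpoly set)"
    by (simp add: closed_ideal_def jet0_ideal_jets0 implied_jet_def)
  then show "I \<in> {I. closed_ideal m I}" if "I \<in> {{0}, jets0 m}" for I :: "1 rpoly set"
    using that closed_ideal_zero by auto
qed

section \<open>Vanishing jets of the whole space and of the origin\<close>

lemma vanishing_jets_UNIV: "vanishing_jets m UNIV = {0}"
proof -
  have "jet m F = 0" if "\<forall>x. F x = 0" for F :: "real ^ 'a \<Rightarrow> real"
    using that jet_zero_fun[of m] by (metis ext)
  then show ?thesis
    by (auto simp: vanishing_jets_def jet_zero_fun intro!: exI[of _ "\<lambda>_. 0"] Ck_on_zero_fun)
qed

lemma vanishing_jets_singleton_0: "vanishing_jets m {0} = jets0 m"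
proof (intro equalityI subsetI)
  fix p :: "'a rpoly" assume p: "p \<in> jets0 m"
  then show "p \<in> vanishing_jets m {0}"
    by (auto simp: vanishing_jets_def jets0_def jet_peval Ck_on_peval intro!: exI[of _ "peval p"])
qed (auto simp: vanishing_jets_def jet_in_jets0)

theorem theorem1p2:
  fixes m :: nat
  assumes "m \<ge> 1"
  shows "(\<forall>I :: 'n::finite rpoly set. jet0_ideal 1 I \<longrightarrow>
            closed_ideal 1 I \<and>
            (\<exists>E :: (real ^ 'n) set. semialgebraic E \<and> 0 \<in> E \<and> I = vanishing_jets 1 E)) \<and>
         {I :: 1 rpoly set. closed_ideal m I} = {{0}, jets0 m} \<and>
         {0} = vanishing_jets m (UNIV :: (real ^ 1) set) \<and>
         (jets0 m :: 1 rpoly set) = vanishing_jets m {0 :: real ^ 1}"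
proof (intro conjI allI impI)
  fix I :: "'n rpoly set" assume I: "jet0_ideal 1 I"
  show "closed_ideal 1 I" using I by (rule closed_ideal_1)
  \<comment> \<open>The zero set of the ideal serves as \<open>E\<close>; as an orthogonal
    complement it contains the origin.\<close>
  show "\<exists>E. semialgebraic E \<and> 0 \<in> E \<and> I = vanishing_jets 1 E"
    using semialgebraic_zero_set_1[OF I] vanishing_jets_1_zero_set[OF I]
      subspace_0[OF subspace_orthogonal_comp] zero_set_eq_orthogonal_comp[OF I]
    by (intro exI[of _ "zero_set I"]) simp
qed (simp_all add: closed_ideals_1 vanishing_jets_UNIV vanishing_jets_singleton_0)

end
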